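(* Let $n,m,r,k$ be arbitrary positive integers. The number of permutations $\sigma$ of $[n]$ with $\sigma(n)=k$ and exactly $m$ $r$-descents is equal to the number of permutations $\sigma$ of $[n]$ with $\sigma(n)=k$ and exactly $m$ $r$-excedances.
   Context: $[n]=\{1,\dots,n\}$, and a permutation of $[n]$ is a bijection $\sigma:[n]\to[n]$. An $r$-descent of $\sigma$ is a position $i$ with $1\le i<n$ and $\sigma(i)\ge\sigma(i+1)+r$. An $r$-excedance of $\sigma$ is a position $i$ with $1\le i\le n$ and $\sigma(i)\ge i+r$. *)

theory Defs
  imports Main "HOL-Combinatorics.Permutations"
begin

definition r_descents :: "nat \<Rightarrow> nat \<Rightarrow> (nat \<Rightarrow> nat) \<Rightarrow> nat set" where
  "r_descents n r \<sigma> = {i. 1 \<le> i \<and> i < n \<and> \<sigma> i \<ge> \<sigma> (i + 1) + r}"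

definition r_excedances :: "nat \<Rightarrow> nat \<Rightarrow> (nat \<Rightarrow> nat) \<Rightarrow> nat set" where
  "r_excedances n r \<sigma> = {i. 1 \<le> i \<and> i \<le> n \<and> \<sigma> i \<ge> i + r}"

end

theory Submission
  imports Defs
begin

text \<open>
  Both sides satisfy the same recurrence in \<open>n\<close>. If \<open>\<sigma> n = n\<close>, delete the last position. Otherwise
  a permutation \<open>\<sigma>\<close> of \<open>[n+1]\<close> with \<open>\<sigma> (n+1) = k \<le> n\<close> arises from a permutation \<open>\<tau>\<close> of \<open>[n]\<close> with
  \<open>\<tau> n = k\<close> and a position \<open>p \<in> [n]\<close> that is to carry the value \<open>n+1\<close>. For descents, \<open>n+1\<close> is
  inserted into the word of \<open>\<tau>\<close> before position \<open>p\<close>. For excedances, \<open>n+1\<close> replaces \<open>\<tau> p\<close>, which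
  moves to position \<open>n\<close>, while \<open>k\<close> moves to position \<open>n+1\<close>. In both cases, if \<open>\<tau>\<close> has statistic \<open>j\<close>,
  then exactly \<open>n + 1 - r - j\<close> positions \<open>p\<close> raise it by one, and all others preserve it.
\<close>

section \<open>Extending a permutation by one point while keeping its last value\<close>

definition perms_ending :: "nat \<Rightarrow> nat \<Rightarrow> (nat \<Rightarrow> nat) set" where
  "perms_ending n k = {\<sigma>. \<sigma> permutes {1..n} \<and> \<sigma> n = k}"

lemma finite_perms_ending: "finite (perms_ending n k)"
  unfolding perms_ending_def
  by (rule finite_subset[OF _ finite_permutations[of "{1..n}"]]) auto

text \<open>As \<open>\<tau>\<close> fixes \<open>Suc n\<close>, the composite has its maximum at
  \<open>p\<close> and ends in \<open>\<tau> n\<close>. Conversely \<open>p\<close> is found as the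
  position of the maximum, and undoing \<open>q p\<close> returns \<open>\<tau>\<close>. The
  abstract \<open>q\<close> lets both insertion moves share this argument.\<close>

lemma bij_betw_perms_ending_Suc:
  assumes "n \<ge> 1" and "k \<le> n"
    and q: "\<And>p. p \<in> {1..n} \<Longrightarrow> q p permutes {1..Suc n}"
    and qp: "\<And>p. p \<in> {1..n} \<Longrightarrow> q p p = Suc n"
    and qn: "\<And>p. p \<in> {1..n} \<Longrightarrow> q p (Suc n) = n"
  shows "bij_betw (\<lambda>(\<tau>, p). \<tau> \<circ> q p) (perms_ending n k \<times> {1..n}) (perms_ending (Suc n) k)"
  unfolding bij_betw_def
proof
  have at_p: "(\<tau> \<circ> q p) p = Suc n" if "\<tau> \<in> perms_ending n k" "p \<in> {1..n}" for \<tau> p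
    using that qp[of p] by (auto simp: perms_ending_def permutes_def)
  have range: "\<tau> \<circ> q p \<in> perms_ending (Suc n) k" if "\<tau> \<in> perms_ending n k" "p \<in> {1..n}" for \<tau> p
  proof -
    have "\<tau> permutes {1..Suc n}"
      using that(1) by (auto simp: perms_ending_def intro: permutes_subset)
    then show ?thesis
      using permutes_compose[OF q[OF that(2)]] that qn[of p] by (auto simp: perms_ending_def)
  qed
  show "inj_on (\<lambda>(\<tau>, p). \<tau> \<circ> q p) (perms_ending n k \<times> {1..n})"
  proof (rule inj_onI, clarify)
    fix \<tau> p \<tau>' p'
    assume *: "\<tau> \<in> perms_ending n k" "p \<in> {1..n}" "\<tau>' \<in> perms_ending n k" "p' \<in> {1..n}"
      and eq: "\<tau> \<circ> q p = \<tau>' \<circ> q p'"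
    have "inj (\<tau> \<circ> q p)"
      using range[OF *(1,2)] by (auto simp: perms_ending_def intro: permutes_inj)
    then have "p = p'"
      using at_p[OF *(1,2)] at_p[OF *(3,4)] eq by (metis injD)
    moreover have "\<tau> = \<tau>'"
      using eq permutes_surj[OF q[OF *(2)]] unfolding \<open>p = p'\<close>
      by (metis comp_assoc comp_id surj_iff)
    ultimately show "\<tau> = \<tau>' \<and> p = p'" by simp
  qed
  have "\<sigma> \<in> (\<lambda>(\<tau>, p). \<tau> \<circ> q p) ` (perms_ending n k \<times> {1..n})"
    if \<sigma>: "\<sigma> \<in> perms_ending (Suc n) k" for \<sigma>
  proof -
    have perm: "\<sigma> permutes {1..Suc n}" and k: "\<sigma> (Suc n) = k"
      using \<sigma> by (auto simp: perms_ending_def)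
    obtain p where p: "p \<in> {1..Suc n}" "\<sigma> p = Suc n"
      using permutes_image[OF perm] by (metis atLeastAtMost_iff imageE le_add1 order_refl plus_1_eq_Suc)
    with k assms have pn: "p \<in> {1..n}"
      by (cases "p = Suc n") auto
    define \<tau> where "\<tau> = \<sigma> \<circ> inv (q p)"
    have "\<tau> permutes {1..Suc n}"
      unfolding \<tau>_def using permutes_compose[OF permutes_inv[OF q[OF pn]] perm] .
    moreover have inv: "inv (q p) (Suc n) = p" "inv (q p) n = Suc n"
      using qp[OF pn] qn[OF pn] permutes_inverses(2)[OF q[OF pn]] by metis+
    \<comment> \<open>Fixing \<open>Suc n\<close> is what makes \<open>\<tau>\<close> a permutation
      of \<open>{1..n}\<close>.\<close>
    then have "\<tau> (Suc n) = Suc n" "\<tau> n = k"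
      using p k by (auto simp: \<tau>_def)
    ultimately have "\<tau> \<in> perms_ending n k"
      by (auto simp: perms_ending_def le_Suc_eq intro: permutes_superset)
    moreover have "\<sigma> = \<tau> \<circ> q p"
      using permutes_inverses(2)[OF q[OF pn]] by (auto simp: \<tau>_def fun_eq_iff)
    ultimately show ?thesis using pn by force
  qed
  then show "(\<lambda>(\<tau>, p). \<tau> \<circ> q p) ` (perms_ending n k \<times> {1..n}) = perms_ending (Suc n) k"
    using range by auto
qed

section \<open>Transferring a distribution along an extension\<close>

text \<open>Double counting: pull the count back along \<open>f\<close> to pairs, then group the
  first components by their value of \<open>s\<close>, on which alone the number of admissible
  \<open>c\<close> depends.\<close>

lemma card_fibre_bij_betw:
  assumes bij: "bij_betw f (A \<times> C) B" and fin: "finite A" "finite C"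
    and fibre: "\<And>a m. a \<in> A \<Longrightarrow> card {c \<in> C. t (f (a, c)) = m} = g m (s a)"
  shows "card {b \<in> B. t b = m} = (\<Sum>j \<in> s ` A. card {a \<in> A. s a = j} * g m j)"
proof -
  have "{b \<in> B. t b = m} = f ` (SIGMA a:A. {c \<in> C. t (f (a, c)) = m})"
    using bij by (auto simp: bij_betw_def)
  moreover have "inj_on f (SIGMA a:A. {c \<in> C. t (f (a, c)) = m})"
    using bij by (auto simp: bij_betw_def intro: inj_on_subset)
  ultimately have "card {b \<in> B. t b = m} = card (SIGMA a:A. {c \<in> C. t (f (a, c)) = m})"
    by (simp add: card_image)
  also have "\<dots> = (\<Sum>a\<in>A. g m (s a))"
    using fin fibre by simp
  also have "\<dots> = (\<Sum>j \<in> s ` A. \<Sum>a | a \<in> A \<and> s a = j. g m (s a))"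
    by (rule sum.image_gen[OF fin(1)])
  also have "\<dots> = (\<Sum>j \<in> s ` A. card {a \<in> A. s a = j} * g m j)"
    by (rule sum.cong) auto
  finally show ?thesis .
qed

text \<open>The induction step in abstract form: the same \<open>g\<close> serves both statistics,
  so each count is the same function of the distribution on \<open>A\<close>.\<close>

lemma equidistributed_extension:
  fixes s s' :: "'a \<Rightarrow> 'j"
  assumes "bij_betw f (A \<times> C) B" "bij_betw f' (A \<times> C) B"
    and fin: "finite A" "finite C"
    and "\<And>a m. a \<in> A \<Longrightarrow> card {c \<in> C. t (f (a, c)) = m} = g m (s a)"
    and "\<And>a m. a \<in> A \<Longrightarrow> card {c \<in> C. t' (f' (a, c)) = m} = g m (s' a)"
    and eq: "\<And>j. card {a \<in> A. s a = j} = card {a \<in> A. s' a = j}"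
  shows "card {b \<in> B. t b = m} = card {b \<in> B. t' b = m}"
proof -
  \<comment> \<open>The two sums must range over the same values; a value is attained exactly when
    its count is nonzero.\<close>
  have "j \<in> s ` A \<longleftrightarrow> j \<in> s' ` A" for j
  proof -
    have "j \<in> u ` A \<longleftrightarrow> card {a \<in> A. u a = j} \<noteq> 0" for u :: "'a \<Rightarrow> 'j"
      using fin by auto
    then show ?thesis using eq by metis
  qed
  then have "s ` A = s' ` A" by blast
  then show ?thesis
    using card_fibre_bij_betw[where t = t and s = s and g = g, OF assms(1) fin assms(5)]
      card_fibre_bij_betw[where t = t' and s = s' and g = g, OF assms(2) fin assms(6)] eq
    by simp
qed

lemma card_fibre_increment:
  assumes "finite C" and "\<And>c. c \<in> C \<Longrightarrow> u c = (if c \<in> I then Suc j else j)" and "I \<subseteq> C"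
  shows "card {c \<in> C. u c = m}
    = (if m = j then card C - card I else if m = Suc j then card I else (0::nat))"
proof -
  have "{c \<in> C. u c = m} = (if m = j then C - I else if m = Suc j then I else {})"
  proof -
    have "{c \<in> C. u c = m} = {c \<in> C. (if c \<in> I then Suc j else j) = m}"
      using assms(2) by (intro Collect_cong conj_cong) simp_all
    then show ?thesis
      using \<open>I \<subseteq> C\<close> by auto
  qed
  then show ?thesis
    using card_Diff_subset[OF finite_subset[OF \<open>I \<subseteq> C\<close> \<open>finite C\<close>] \<open>I \<subseteq> C\<close>] by simp
qed

section \<open>The two insertion moves and their effect on the statistics\<close>

text \<open>For \<open>1 \<le> p \<le> n\<close>, the cycle p -> n -> n-1 -> ... -> p+1 -> p.
  Composed on the right, it moves the last letter of a word to position \<open>p\<close> and shifts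
  the letters from there on to the right.\<close>

definition insertion_cycle :: "nat \<Rightarrow> nat \<Rightarrow> nat \<Rightarrow> nat" where
  "insertion_cycle n p i = (if i = p then n else if p < i \<and> i \<le> n then i - 1 else i)"

lemma insertion_cycle_permutes:
  assumes "1 \<le> p" "p \<le> n"
  shows "insertion_cycle n p permutes {1..n}"
proof (rule bij_imp_permutes)
  have "inj_on (insertion_cycle n p) {1..n}"
    using assms by (auto simp: inj_on_def insertion_cycle_def split: if_splits)
  moreover have "insertion_cycle n p ` {1..n} \<subseteq> {1..n}"
    using assms by (auto simp: insertion_cycle_def)
  ultimately show "bij_betw (insertion_cycle n p) {1..n} {1..n}"
    by (simp add: bij_betw_def endo_inj_surj)
qed (use assms in \<open>auto simp: insertion_cycle_def\<close>)

text \<open>For \<open>p < n\<close> the 3-cycle p -> n+1 -> n -> p; for \<open>p = n\<close> it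
  degenerates to the swap of \<open>n\<close> and \<open>Suc n\<close>.\<close>

definition excedance_cycle :: "nat \<Rightarrow> nat \<Rightarrow> nat \<Rightarrow> nat" where
  "excedance_cycle n p = transpose n (Suc n) \<circ> transpose p n"

lemma excedance_cycle_permutes:
  assumes "p \<in> {1..n}"
  shows "excedance_cycle n p permutes {1..Suc n}"
  unfolding excedance_cycle_def using assms
  by (intro permutes_compose permutes_swap_id) auto

lemma finite_r_descents: "finite (r_descents n r \<sigma>)"
  by (rule finite_subset[of _ "{..n}"]) (auto simp: r_descents_def)

lemma finite_r_excedances: "finite (r_excedances n r \<sigma>)"
  by (rule finite_subset[of _ "{..n}"]) (auto simp: r_excedances_def)

text \<open>The insertion breaks only the adjacency of \<open>p - 1\<close> and \<open>p\<close>.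
  The ascent to the new maximum is no descent, and the step down from it to \<open>\<tau> p\<close>
  is an r-descent exactly when \<open>\<tau> p + r \<le> Suc n\<close>.\<close>

lemma r_descents_insertion:
  assumes \<tau>: "\<tau> permutes {1..n}" and p: "p \<in> {1..n}" and "r \<ge> 1"
  shows "card (r_descents (Suc n) r (\<tau> \<circ> insertion_cycle (Suc n) p)) =
    (if \<tau> p + r \<le> Suc n \<and> p \<notin> Suc ` r_descents n r \<tau>
     then Suc (card (r_descents n r \<tau>)) else card (r_descents n r \<tau>))"
proof -
  let ?\<sigma> = "\<tau> \<circ> insertion_cycle (Suc n) p"
  let ?D = "r_descents n r \<tau>"
  \<comment> \<open>Tracks where a surviving descent of \<open>\<tau>\<close> ends up. For
    \<open>p = 1\<close> the removed position \<open>p - 1\<close> is 0, which is never a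
    descent.\<close>
  let ?h = "\<lambda>i. if Suc i < p then i else Suc i"
  have le: "i \<in> {1..n} \<Longrightarrow> \<tau> i \<le> n" for i
    using permutes_in_image[OF \<tau>, of i] by auto
  have top: "\<tau> (Suc n) = Suc n"
    using \<tau> by (auto simp: permutes_def)
  have low: "?\<sigma> i = \<tau> i" if "i < p" for i
    using that p by (auto simp: insertion_cycle_def)
  have mid: "?\<sigma> p = Suc n"
    using top by (auto simp: insertion_cycle_def)
  have high: "?\<sigma> (Suc i) = \<tau> i" if "p \<le> i" "i \<le> n" for i
    using that by (auto simp: insertion_cycle_def)
  have in_iff: "i \<in> r_descents (Suc n) r ?\<sigma> \<longleftrightarrow>
      i \<in> ?h ` (?D - {p - 1}) \<union> (if \<tau> p + r \<le> Suc n then {p} else {})" for i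
  proof -
    consider "Suc i < p" | "Suc i = p" | "i = p" | j where "i = Suc j" "p \<le> j"
      by (metis Suc_lessI linorder_neqE_nat less_Suc_eq_le less_imp_Suc_add le_add1)
    then show ?thesis
    proof cases
      case 1
      then show ?thesis using low[of i] low[of "Suc i"] p
        by (auto simp: r_descents_def image_iff split: if_splits)
    next
      case 2
      then show ?thesis using low[of i] mid le[of i] p \<open>r \<ge> 1\<close>
        by (auto simp: r_descents_def image_iff split: if_splits)
    next
      case 3
      then show ?thesis using mid high[of p] p
        by (auto simp: r_descents_def image_iff split: if_splits)
    next
      case 4
      then show ?thesis using high[of j] high[of "Suc j"] p
        by (auto simp: r_descents_def image_iff split: if_splits)
    qed
  qed
  then have eq: "r_descents (Suc n) r ?\<sigma> =
      ?h ` (?D - {p - 1}) \<union> (if \<tau> p + r \<le> Suc n then {p} else {})"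
    by blast
  have "inj_on ?h (?D - {p - 1})"
    by (auto simp: inj_on_def split: if_splits)
  then have cardh: "card (?h ` (?D - {p - 1})) = card (?D - {p - 1})"
    by (rule card_image)
  have notin: "p \<notin> ?h ` (?D - {p - 1})"
    by (auto split: if_splits)
  have mem: "p \<in> Suc ` ?D \<longleftrightarrow> p - 1 \<in> ?D"
    using p by (cases p) auto
  \<comment> \<open>A descent lost at \<open>p - 1\<close> is always compensated by the new one at
    \<open>p\<close>, so the count never drops.\<close>
  have imp: "p \<in> Suc ` ?D \<Longrightarrow> \<tau> p + r \<le> Suc n"
    using le by (force simp: r_descents_def)
  have *: "card ?D = Suc (card (?D - {p - 1}))" if "p - 1 \<in> ?D"
    using that finite_r_descents by (metis card_Suc_Diff1)
  show ?thesis
    unfolding eq using notin cardh mem imp * finite_r_descents[of n r \<tau>]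
    by (auto simp: card_insert_if)
qed

text \<open>Positions \<open>n\<close> (if different from \<open>p\<close>) and \<open>Suc n\<close>
  receive values at most \<open>n\<close>, so they are no r-excedances; only the status of
  \<open>p\<close> can change.\<close>

lemma r_excedances_insertion:
  assumes \<tau>: "\<tau> permutes {1..n}" and p: "p \<in> {1..n}" and "r \<ge> 1"
  shows "card (r_excedances (Suc n) r (\<tau> \<circ> excedance_cycle n p)) =
    (if p + r \<le> Suc n \<and> p \<notin> r_excedances n r \<tau>
     then Suc (card (r_excedances n r \<tau>)) else card (r_excedances n r \<tau>))"
proof -
  let ?\<sigma> = "\<tau> \<circ> excedance_cycle n p"
  let ?E = "r_excedances n r \<tau>"
  have le: "i \<in> {1..n} \<Longrightarrow> \<tau> i \<le> n" for i
    using permutes_in_image[OF \<tau>, of i] by auto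
  have top: "\<tau> (Suc n) = Suc n"
    using \<tau> by (auto simp: permutes_def)
  \<comment> \<open>Testing \<open>i = p\<close> first also covers the degenerate case
    \<open>p = n\<close>.\<close>
  have val: "?\<sigma> i = (if i = p then Suc n else if i = n then \<tau> p
      else if i = Suc n then \<tau> n else \<tau> i)" for i
    using p top by (auto simp: excedance_cycle_def transpose_def)
  have "i \<in> r_excedances (Suc n) r ?\<sigma> \<longleftrightarrow>
      i \<in> (?E - {p}) \<union> (if p + r \<le> Suc n then {p} else {})" for i
    using p \<open>r \<ge> 1\<close> le[of i] le[of p] le[of n]
    unfolding r_excedances_def mem_Collect_eq val by auto
  then have eq: "r_excedances (Suc n) r ?\<sigma> =
      (?E - {p}) \<union> (if p + r \<le> Suc n then {p} else {})"
    by blast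
  have imp: "p \<in> ?E \<Longrightarrow> p + r \<le> Suc n"
    using le[of p] by (auto simp: r_excedances_def)
  have *: "card ?E = Suc (card (?E - {p}))" if "p \<in> ?E"
    using that finite_r_excedances by (metis card_Suc_Diff1)
  show ?thesis
    unfolding eq using imp * finite_r_excedances[of n r \<tau>]
    by (cases "p \<in> ?E") (auto simp: card_insert_if)
qed

section \<open>Counting the positions that raise a statistic\<close>

text \<open>\<open>\<tau>\<close> matches the positions meeting the bound with the values
  \<open>1\<close> to \<open>Suc n - r\<close>, and every successor of an r-descent is among these
  positions.\<close>

lemma card_descent_increments:
  assumes \<tau>: "\<tau> permutes {1..n}" and "r \<ge> 1"
  shows "card {p \<in> {1..n}. \<tau> p + r \<le> Suc n \<and> p \<notin> Suc ` r_descents n r \<tau>}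
    = Suc n - r - card (r_descents n r \<tau>)"
proof -
  let ?V = "{p \<in> {1..n}. \<tau> p + r \<le> Suc n}"
  have "\<tau> ` ?V = {1..Suc n - r}"
  proof
    show "\<tau> ` ?V \<subseteq> {1..Suc n - r}"
      using permutes_in_image[OF \<tau>] by fastforce
    show "{1..Suc n - r} \<subseteq> \<tau> ` ?V"
    proof
      fix v assume v: "v \<in> {1..Suc n - r}"
      then have "v \<in> \<tau> ` {1..n}"
        using permutes_image[OF \<tau>] \<open>r \<ge> 1\<close> by auto
      then show "v \<in> \<tau> ` ?V" using v by auto
    qed
  qed
  then have V: "card ?V = Suc n - r"
    using card_image[OF inj_on_subset[OF permutes_inj[OF \<tau>] subset_UNIV], of ?V] by simp
  have sub: "Suc ` r_descents n r \<tau> \<subseteq> ?V"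
  proof -
    have "\<tau> i \<le> n" if "1 \<le> i" "i < n" for i
      using permutes_in_image[OF \<tau>, of i] that by auto
    then show ?thesis by (force simp: r_descents_def)
  qed
  have "{p \<in> {1..n}. \<tau> p + r \<le> Suc n \<and> p \<notin> Suc ` r_descents n r \<tau>} = ?V - Suc ` r_descents n r \<tau>"
    by blast
  then show ?thesis
    using sub V by (simp add: card_Diff_subset finite_r_descents card_image)
qed

text \<open>Here the bound restricts positions instead of values, but leaves equally many, and every
  r-excedance obeys it. Hence the same function of the statistic as for descents.\<close>

lemma card_excedance_increments:
  assumes \<tau>: "\<tau> permutes {1..n}" and "r \<ge> 1"
  shows "card {p \<in> {1..n}. p + r \<le> Suc n \<and> p \<notin> r_excedances n r \<tau>}
    = Suc n - r - card (r_excedances n r \<tau>)"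
proof -
  have "r_excedances n r \<tau> \<subseteq> {1..Suc n - r}"
  proof
    fix i assume "i \<in> r_excedances n r \<tau>"
    then show "i \<in> {1..Suc n - r}"
      using permutes_in_image[OF \<tau>, of i] by (auto simp: r_excedances_def)
  qed
  moreover have "{p \<in> {1..n}. p + r \<le> Suc n \<and> p \<notin> r_excedances n r \<tau>}
      = {1..Suc n - r} - r_excedances n r \<tau>"
    using \<open>r \<ge> 1\<close> by auto
  ultimately show ?thesis
    by (simp add: card_Diff_subset finite_r_excedances)
qed

section \<open>A fixed last point, and the induction\<close>

lemma perms_ending_Suc_fixed:
  "\<sigma> \<in> perms_ending (Suc n) (Suc n) \<longleftrightarrow> \<sigma> permutes {1..n}"
  by (auto simp: perms_ending_def le_Suc_eq permutes_not_in
      intro: permutes_superset permutes_subset)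

lemma r_descents_Suc_fixed:
  assumes "\<sigma> permutes {1..n}" "r \<ge> 1"
  shows "r_descents (Suc n) r \<sigma> = r_descents n r \<sigma>"
proof -
  have "\<sigma> (Suc n) = Suc n" using assms by (auto simp: permutes_def)
  moreover have "n \<ge> 1 \<Longrightarrow> \<sigma> n \<le> n" using permutes_in_image[OF assms(1), of n] by auto
  ultimately show ?thesis
    using assms by (auto simp: r_descents_def less_Suc_eq)
qed

lemma r_excedances_Suc_fixed:
  assumes "\<sigma> permutes {1..n}" "r \<ge> 1"
  shows "r_excedances (Suc n) r \<sigma> = r_excedances n r \<sigma>"
proof -
  have "\<sigma> (Suc n) = Suc n" using assms by (auto simp: permutes_def)
  then show ?thesis
    using assms by (auto simp: r_excedances_def le_Suc_eq)
qed

text \<open>Deleting a fixed last point leaves the new last value free; this splits the count into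
  classes covered by the induction hypothesis. The index 0 contributes only for
  \<open>n = 0\<close>, where \<open>\<sigma> 0 = 0\<close>.\<close>

lemma card_permutes_by_last:
  "card {\<sigma>. \<sigma> permutes {1..n} \<and> P \<sigma>} = (\<Sum>k\<le>n. card {\<sigma> \<in> perms_ending n k. P \<sigma>})"
proof -
  have "\<sigma> n \<le> n" if "\<sigma> permutes {1..n}" for \<sigma> :: "nat \<Rightarrow> nat"
    using permutes_in_image[OF that, of n] permutes_not_in[OF that, of n] by (cases n) auto
  then have "{\<sigma>. \<sigma> permutes {1..n} \<and> P \<sigma>} = (\<Union>k\<le>n. {\<sigma> \<in> perms_ending n k. P \<sigma>})"
    by (auto simp: perms_ending_def)
  also have "card \<dots> = (\<Sum>k\<le>n. card {\<sigma> \<in> perms_ending n k. P \<sigma>})"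
    by (rule card_UN_disjoint) (auto simp: finite_perms_ending, auto simp: perms_ending_def)
  finally show ?thesis .
qed

lemma equidistributed_perms_ending:
  assumes r: "r \<ge> 1"
  shows "card {\<sigma> \<in> perms_ending n k. card (r_descents n r \<sigma>) = m}
    = card {\<sigma> \<in> perms_ending n k. card (r_excedances n r \<sigma>) = m}"
proof (induction n arbitrary: k m)
  case 0
  have "r_descents 0 r \<sigma> = {}" "r_excedances 0 r \<sigma> = {}" for \<sigma>
    by (auto simp: r_descents_def r_excedances_def)
  then show ?case by simp
next
  case (Suc n)
  consider "k = Suc n" | "k > Suc n" | "k = 0" | "n \<ge> 1" "k \<le> n" by linarith
  then show ?case
  proof cases
    case 1
    have "{\<sigma> \<in> perms_ending (Suc n) k. card (r_descents (Suc n) r \<sigma>) = m}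
        = {\<sigma>. \<sigma> permutes {1..n} \<and> card (r_descents n r \<sigma>) = m}"
      "{\<sigma> \<in> perms_ending (Suc n) k. card (r_excedances (Suc n) r \<sigma>) = m}
        = {\<sigma>. \<sigma> permutes {1..n} \<and> card (r_excedances n r \<sigma>) = m}"
      unfolding 1 perms_ending_Suc_fixed
      using r by (auto simp: r_descents_Suc_fixed r_excedances_Suc_fixed)
    then show ?thesis
      by (simp only: card_permutes_by_last Suc.IH)
  next
    case 4
    \<comment> \<open>Number of positions in \<open>{1..n}\<close> that take the statistic from
      \<open>j\<close> to \<open>m\<close>: first those preserving it, then those raising
      it.\<close>
    define g where "g m j = (if m = j then n - (Suc n - r - j)
      else if m = Suc j then Suc n - r - j else 0)" for m j
    show ?thesis
    proof (rule equidistributed_extension[where g = g and C = "{1..n}"])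
      show "bij_betw (\<lambda>(\<tau>, p). \<tau> \<circ> insertion_cycle (Suc n) p)
          (perms_ending n k \<times> {1..n}) (perms_ending (Suc n) k)"
        using 4 by (intro bij_betw_perms_ending_Suc insertion_cycle_permutes)
          (auto simp: insertion_cycle_def)
      show "bij_betw (\<lambda>(\<tau>, p). \<tau> \<circ> excedance_cycle n p)
          (perms_ending n k \<times> {1..n}) (perms_ending (Suc n) k)"
        using 4 by (intro bij_betw_perms_ending_Suc excedance_cycle_permutes)
          (auto simp: excedance_cycle_def transpose_def)
      fix \<tau> m assume "\<tau> \<in> perms_ending n k"
      then have \<tau>: "\<tau> permutes {1..n}" by (simp add: perms_ending_def)
      show "card {p \<in> {1..n}. card (r_descents (Suc n) r
          ((\<lambda>(\<tau>, p). \<tau> \<circ> insertion_cycle (Suc n) p) (\<tau>, p))) = m} = g m (card (r_descents n r \<tau>))"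
        unfolding g_def card_descent_increments[OF \<tau> r, symmetric] prod.case
        by (subst card_fibre_increment[where j = "card (r_descents n r \<tau>)"
              and I = "{p \<in> {1..n}. \<tau> p + r \<le> Suc n \<and> p \<notin> Suc ` r_descents n r \<tau>}"])
          (auto simp: r_descents_insertion[OF \<tau> _ r])
      show "card {p \<in> {1..n}. card (r_excedances (Suc n) r
          ((\<lambda>(\<tau>, p). \<tau> \<circ> excedance_cycle n p) (\<tau>, p))) = m} = g m (card (r_excedances n r \<tau>))"
        unfolding g_def card_excedance_increments[OF \<tau> r, symmetric] prod.case
        by (subst card_fibre_increment[where j = "card (r_excedances n r \<tau>)"
              and I = "{p \<in> {1..n}. p + r \<le> Suc n \<and> p \<notin> r_excedances n r \<tau>}"])
          (auto simp: r_excedances_insertion[OF \<tau> _ r])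
    qed (use Suc.IH finite_perms_ending in auto)
  next
    case 2
    then have "perms_ending (Suc n) k = {}"
      using permutes_in_image[of _ "{1..Suc n}" "Suc n"] by (fastforce simp: perms_ending_def)
    then show ?thesis by simp
  next
    case 3
    then have "perms_ending (Suc n) k = {}"
      using permutes_in_image[of _ "{1..Suc n}" "Suc n"] by (fastforce simp: perms_ending_def)
    then show ?thesis by simp
  qed
qed

theorem theorem4:
  fixes n m r k :: nat
  assumes "n \<ge> 1" and "m \<ge> 1" and "r \<ge> 1" and "k \<ge> 1"
  shows "card {\<sigma>. \<sigma> permutes {1..n} \<and> \<sigma> n = k \<and> card (r_descents n r \<sigma>) = m}
       = card {\<sigma>. \<sigma> permutes {1..n} \<and> \<sigma> n = k \<and> card (r_excedances n r \<sigma>) = m}"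
  using equidistributed_perms_ending[OF \<open>r \<ge> 1\<close>, of n k m]
  by (simp add: perms_ending_def)

end
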